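(* Let $X$ be a metric space. If $X$ has finite weak hyperbolic dimension, then $X$ has weak finite decomposition complexity. If $X$ has weak hyperbolic dimension at most $1$, then $X$ has (strong) finite decomposition complexity.
   Context: A metric family is a (countable) collection of metric spaces; a single metric space $X$ is viewed as the metric family $\{X\}$. Decomposition: Let $r>0$ and let $n$ be a non-negative integer. A metric family $\mathcal{X}$ is $(r,n)$-decomposable over a metric family $\mathcal{Y}$ if every $X\in\mathcal{X}$ can be written as $X=X_0\cup X_1\cup\cdots\cup X_n$ such that each $X_i$ is an $r$-disjoint union $X_i=\bigsqcup_j X_{ij}$ with each $X_{ij}$ in $\mathcal{Y}$ (subsets carry the subspace metric). Here $r$-disjoint means $d(U,V)>r$ for any two distinct members $U\neq V$ of the union. If $\mathfrak{C}$ is a collection of metric families, $\mathcal{X}$ is $n$-decomposable over $\mathfrak{C}$ if for every $r>0$ it is $(r,n)$-decomposable over some metric family $\mathcal{Y}$ in $\mathfrak{C}$. It is weakly decomposable over $\mathfrak{C}$ if it is $n$-decomposable over $\mathfrak{C}$ for some non-negative integer $n$, and strongly decomposable over $\mathfrak{C}$ if it is $1$-decomposable over $\mathfrak{C}$. A collection $\mathfrak{C}$ is closed under weak (resp. strong) decomposition if every metric family that is weakly (resp. strongly) decomposable over $\mathfrak{C}$ belongs to $\mathfrak{C}$. Finite decomposition complexity: A metric family $\mathcal{Z}$ is bounded if $\sup\{\operatorname{diam}(Z)\mid Z\in\mathcal{Z}\}<\infty$; $\mathfrak{B}$ denotes the collection of all bounded metric families. Let $\mathfrak{D}$ (resp.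 $w\mathfrak{D}$) be the smallest collection of metric families containing $\mathfrak{B}$ that is closed under strong (resp. weak) decomposition. A metric family in $\mathfrak{D}$ has (strong) finite decomposition complexity; a metric family in $w\mathfrak{D}$ has weak finite decomposition complexity. Weak hyperbolic dimension: Let $N$ be a positive integer and $R>0$. A subset $Y\subset X$ of a metric space $(X,d)$ is $(N,R)$-large scale doubling if for every $x\in X$ and every $r\ge R$, the intersection of $Y$ with the ball in $X$ of radius $2r$ centered at $x$ can be covered by $N$ balls of radius $r$ with centers in $X$. A metric family $\mathcal{Y}$ of subsets of a metric space $X$ is weakly large scale doubling if there exists $(N,R)$ such that each $Y\in\mathcal{Y}$ is $(N,R)$-large scale doubling. Let $w\mathfrak{L}$ be the collection of weakly large scale doubling metric families. For a non-negative integer $n$, a metric space $X$ has weak hyperbolic dimension at most $n$ if $\{X\}$ is $n$-decomposable over $w\mathfrak{L}$ (where the families used are families of subsets of $X$); the weak hyperbolic dimension of $X$ is the smallest such $n$, and is $\infty$ if no such $n$ exists. *)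

theory Defs
  imports "HOL-Analysis.Analysis"
begin

text \<open>
  A metric family over the type \<^typ>\<open>'a\<close> is a countable set of metric spaces whose
  carriers are subsets of \<^typ>\<open>'a\<close>.  Every notion below involves only the members of a
  family and their subspaces, so fixing the carrier type is harmless.
\<close>

type_synonym 'a metric_family = "'a metric set"

definition metric_family :: "'a metric_family \<Rightarrow> bool" where
  "metric_family \<X> \<longleftrightarrow> countable \<X>"


subsection \<open>Decomposition\<close>

text \<open>The distance is \<open>\<infinity>\<close> if one of the sets is empty.\<close>

definition set_dist :: "'a metric \<Rightarrow> 'a set \<Rightarrow> 'a set \<Rightarrow> ennreal" where
  "set_dist X U V = (INF u\<in>U. INF v\<in>V. ennreal (mdist X u v))"

definition r_disjoint :: "'a metric \<Rightarrow> real \<Rightarrow> 'a set set \<Rightarrow> bool" where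
  "r_disjoint X r \<U> \<longleftrightarrow> (\<forall>U\<in>\<U>. \<forall>V\<in>\<U>. U \<noteq> V \<longrightarrow> set_dist X U V > ennreal r)"

text \<open>The set \<open>\<U> i\<close> consists of the pieces \<open>X\<^sub>i\<^sub>j\<close>, so that \<open>X\<^sub>i = \<Union>(\<U> i)\<close>.\<close>

definition rn_decomposable ::
    "real \<Rightarrow> nat \<Rightarrow> 'a metric_family \<Rightarrow> 'a metric_family \<Rightarrow> bool" where
  "rn_decomposable r n \<X> \<Y> \<longleftrightarrow>
     (\<forall>X\<in>\<X>. \<exists>\<U> :: nat \<Rightarrow> 'a set set.
        mspace X = (\<Union>i\<in>{0..n}. \<Union>(\<U> i)) \<and>
        (\<forall>i\<in>{0..n}. r_disjoint X r (\<U> i) \<and> (\<forall>U\<in>\<U> i. submetric X U \<in> \<Y>)))"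

definition n_decomposable ::
    "nat \<Rightarrow> 'a metric_family \<Rightarrow> 'a metric_family set \<Rightarrow> bool" where
  "n_decomposable n \<X> \<CC> \<longleftrightarrow> (\<forall>r>0. \<exists>\<Y>\<in>\<CC>. rn_decomposable r n \<X> \<Y>)"

definition weakly_decomposable :: "'a metric_family \<Rightarrow> 'a metric_family set \<Rightarrow> bool" where
  "weakly_decomposable \<X> \<CC> \<longleftrightarrow> (\<exists>n. n_decomposable n \<X> \<CC>)"

definition strongly_decomposable :: "'a metric_family \<Rightarrow> 'a metric_family set \<Rightarrow> bool" where
  "strongly_decomposable \<X> \<CC> \<longleftrightarrow> n_decomposable 1 \<X> \<CC>"

definition closed_under_weak_decomposition :: "'a metric_family set \<Rightarrow> bool" where
  "closed_under_weak_decomposition \<CC> \<longleftrightarrow>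
     (\<forall>\<X>. metric_family \<X> \<and> weakly_decomposable \<X> \<CC> \<longrightarrow> \<X> \<in> \<CC>)"

definition closed_under_strong_decomposition :: "'a metric_family set \<Rightarrow> bool" where
  "closed_under_strong_decomposition \<CC> \<longleftrightarrow>
     (\<forall>\<X>. metric_family \<X> \<and> strongly_decomposable \<X> \<CC> \<longrightarrow> \<X> \<in> \<CC>)"


subsection \<open>Finite decomposition complexity\<close>

definition diam :: "'a metric \<Rightarrow> ennreal" where
  "diam X = (SUP x\<in>mspace X. SUP y\<in>mspace X. ennreal (mdist X x y))"

definition bounded_families :: "'a metric_family set" where
  "bounded_families = {\<Z>. metric_family \<Z> \<and> (SUP Z\<in>\<Z>. diam Z) < \<infinity>}"

definition strong_FDC :: "'a metric_family set" where
  "strong_FDC = \<Inter>{\<CC>. (\<forall>\<X>\<in>\<CC>. metric_family \<X>) \<and> bounded_families \<subseteq> \<CC> \<and>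
                       closed_under_strong_decomposition \<CC>}"

definition weak_FDC :: "'a metric_family set" where
  "weak_FDC = \<Inter>{\<CC>. (\<forall>\<X>\<in>\<CC>. metric_family \<X>) \<and> bounded_families \<subseteq> \<CC> \<and>
                     closed_under_weak_decomposition \<CC>}"

text \<open>These intersections are themselves collections of the required kind, hence the smallest.\<close>

lemma n_decomposable_mono:
  "n_decomposable n \<X> \<CC> \<Longrightarrow> \<CC> \<subseteq> \<CC>' \<Longrightarrow> n_decomposable n \<X> \<CC>'"
  unfolding n_decomposable_def by blast

lemma
  shows metric_family_strong_FDC: "\<forall>\<X>\<in>(strong_FDC :: 'a metric_family set). metric_family \<X>"
    and bounded_subset_strong_FDC: "bounded_families \<subseteq> (strong_FDC :: 'a metric_family set)"
    and closed_strong_FDC: "closed_under_strong_decomposition (strong_FDC :: 'a metric_family set)"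
proof -
  have "{\<X> :: 'a metric_family. metric_family \<X>} \<in> {\<CC>. (\<forall>\<X>\<in>\<CC>. metric_family \<X>) \<and> bounded_families \<subseteq> \<CC> \<and>
           closed_under_strong_decomposition \<CC>}"
    by (auto simp: bounded_families_def closed_under_strong_decomposition_def)
  then show "\<forall>\<X>\<in>(strong_FDC :: 'a metric_family set). metric_family \<X>"
    unfolding strong_FDC_def by blast
  show "bounded_families \<subseteq> (strong_FDC :: 'a metric_family set)"
    unfolding strong_FDC_def by blast
  show "closed_under_strong_decomposition (strong_FDC :: 'a metric_family set)"
    unfolding closed_under_strong_decomposition_def strongly_decomposable_def
  proof (intro allI impI)
    fix \<X> :: "'a metric_family"
    assume *: "metric_family \<X> \<and> n_decomposable 1 \<X> strong_FDC"
    show "\<X> \<in> strong_FDC"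
      unfolding strong_FDC_def
    proof (rule InterI)
      fix \<CC> :: "'a metric_family set"
      assume \<CC>: "\<CC> \<in> {\<CC>. (\<forall>\<X>\<in>\<CC>. metric_family \<X>) \<and> bounded_families \<subseteq> \<CC> \<and>
                          closed_under_strong_decomposition \<CC>}"
      then have "strong_FDC \<subseteq> \<CC>" unfolding strong_FDC_def by (rule Inter_lower)
      with * have "n_decomposable 1 \<X> \<CC>" by (blast intro: n_decomposable_mono)
      with * \<CC> show "\<X> \<in> \<CC>"
        unfolding closed_under_strong_decomposition_def strongly_decomposable_def by blast
    qed
  qed
qed

lemma
  shows metric_family_weak_FDC: "\<forall>\<X>\<in>(weak_FDC :: 'a metric_family set). metric_family \<X>"
    and bounded_subset_weak_FDC: "bounded_families \<subseteq> (weak_FDC :: 'a metric_family set)"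
    and closed_weak_FDC: "closed_under_weak_decomposition (weak_FDC :: 'a metric_family set)"
proof -
  have "{\<X> :: 'a metric_family. metric_family \<X>} \<in> {\<CC>. (\<forall>\<X>\<in>\<CC>. metric_family \<X>) \<and> bounded_families \<subseteq> \<CC> \<and>
           closed_under_weak_decomposition \<CC>}"
    by (auto simp: bounded_families_def closed_under_weak_decomposition_def)
  then show "\<forall>\<X>\<in>(weak_FDC :: 'a metric_family set). metric_family \<X>"
    unfolding weak_FDC_def by blast
  show "bounded_families \<subseteq> (weak_FDC :: 'a metric_family set)"
    unfolding weak_FDC_def by blast
  show "closed_under_weak_decomposition (weak_FDC :: 'a metric_family set)"
    unfolding closed_under_weak_decomposition_def weakly_decomposable_def
  proof (intro allI impI)
    fix \<X> :: "'a metric_family"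
    assume *: "metric_family \<X> \<and> (\<exists>n. n_decomposable n \<X> weak_FDC)"
    show "\<X> \<in> weak_FDC"
      unfolding weak_FDC_def
    proof (rule InterI)
      fix \<CC> :: "'a metric_family set"
      assume \<CC>: "\<CC> \<in> {\<CC>. (\<forall>\<X>\<in>\<CC>. metric_family \<X>) \<and> bounded_families \<subseteq> \<CC> \<and>
                          closed_under_weak_decomposition \<CC>}"
      then have "weak_FDC \<subseteq> \<CC>" unfolding weak_FDC_def by (rule Inter_lower)
      with * have "\<exists>n. n_decomposable n \<X> \<CC>" by (blast intro: n_decomposable_mono)
      with * \<CC> show "\<X> \<in> \<CC>"
        unfolding closed_under_weak_decomposition_def weakly_decomposable_def by blast
    qed
  qed
qed


subsection \<open>Weak hyperbolic dimension\<close>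

text \<open>
  Balls are open; using closed balls changes the admissible constants \<open>(N, R)\<close> but not the
  resulting collection of weakly large scale doubling families.  Since \<open>C\<close> may have fewer
  than \<open>N\<close> elements, coinciding balls are allowed.
\<close>

definition large_scale_doubling :: "'a metric \<Rightarrow> nat \<Rightarrow> real \<Rightarrow> 'a set \<Rightarrow> bool" where
  "large_scale_doubling X N R Y \<longleftrightarrow>
     (\<forall>x\<in>mspace X. \<forall>r\<ge>R. \<exists>C. C \<subseteq> mspace X \<and> finite C \<and> card C \<le> N \<and>
        Y \<inter> mball_of X x (2 * r) \<subseteq> (\<Union>c\<in>C. mball_of X c r))"

text \<open>
  Large scale doubling is relative to the ambient space, so the collection is indexed by \<open>X\<close>:
  it consists of the weakly large scale doubling families of subsets of \<open>X\<close>.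
\<close>

definition weakly_LSD_families :: "'a metric \<Rightarrow> 'a metric_family set" where
  "weakly_LSD_families X =
     {\<Y>. metric_family \<Y> \<and>
          (\<exists>\<S>. \<Y> = submetric X ` \<S> \<and> (\<forall>S\<in>\<S>. S \<subseteq> mspace X) \<and>
               (\<exists>N R. N > 0 \<and> R > 0 \<and> (\<forall>S\<in>\<S>. large_scale_doubling X N R S)))}"

definition weak_hyperbolic_dim_at_most :: "'a metric \<Rightarrow> nat \<Rightarrow> bool" where
  "weak_hyperbolic_dim_at_most X n \<longleftrightarrow> n_decomposable n {X} (weakly_LSD_families X)"

text \<open>The infimum of the empty set in \<^typ>\<open>enat\<close> is \<open>\<infinity>\<close>.\<close>

definition weak_hyperbolic_dim :: "'a metric \<Rightarrow> enat" where
  "weak_hyperbolic_dim X = Inf {enat n | n. weak_hyperbolic_dim_at_most X n}"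

end

theory Submission
  imports Defs
begin

text \<open>
  Both claims follow once every weakly large scale doubling family lies in \<^const>\<open>strong_FDC\<close>
  (\<open>weakly_LSD_subset_strong_FDC\<close>): the weak hyperbolic dimension bound says that \<open>{X}\<close> decomposes
  over such families, and \<^const>\<open>strong_FDC\<close>, respectively the larger \<^const>\<open>weak_FDC\<close>, is
  closed under the decomposition in question.

  For the inclusion it is enough to embed the members of a doubling family coarsely into one
  \<open>\<real>\<^sup>m\<close>, with the same dimension and the same control for all members.  Indeed, cutting along one
  1-Lipschitz coordinate into strips wider than \<open>r\<close>, and sorting the strips by the parity of their
  index, is a strong decomposition whose pieces need one coordinate less; when no coordinate is
  left, the family is bounded (\<open>coarse_coordinates_strong_FDC\<close>).

  The embedding (\<open>doubling_coarse_coordinates\<close>) is a large scale form of Assouad's embedding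
  theorem.  At a single scale \<open>s\<close>, doubling bounds the number of colours that suffice to cover a
  set by \<open>s\<close>-balls whose centres, within each colour, are very far apart; the truncated distances
  to the colour classes then tell apart any two points at distance comparable to \<open>s\<close>
  (\<open>separating_functions\<close>).  Each coordinate adds up such functions over a geometric sequence of
  scales, with weight about \<open>1 / \<surd>s\<close> at scale \<open>s\<close>.  These weights are summable, so the sum is
  Lipschitz.  On two points at distance about \<open>s\<close>, the term of scale \<open>s\<close> differs by about \<open>\<surd>s\<close>
  and dominates both the smaller scales (bounded functions) and the larger ones (small weights).
  This domination
  requires the scales within one coordinate to be far apart, and a few interleaved sequences
  together reach all distances.
\<close>

section \<open>Families with finitely many coarse coordinates\<close>

text \<open>
  The functions \<open>f 0, \<dots>, f (m - 1)\<close> form a coarse embedding of \<open>Y\<close> into \<open>\<real>\<^sup>m\<close> with the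
  maximum norm.  The control function \<open>D\<close> is a parameter, so that one \<open>D\<close> can serve a whole
  family.
\<close>

definition coarse_coordinates :: "nat \<Rightarrow> (real \<Rightarrow> real) \<Rightarrow> 'a metric \<Rightarrow> (nat \<Rightarrow> 'a \<Rightarrow> real) \<Rightarrow> bool" where
  "coarse_coordinates m D Y f \<longleftrightarrow>
     (\<forall>i<m. \<forall>x\<in>mspace Y. \<forall>y\<in>mspace Y. \<bar>f i x - f i y\<bar> \<le> mdist Y x y) \<and>
     (\<forall>L. \<forall>x\<in>mspace Y. \<forall>y\<in>mspace Y. (\<forall>i<m. \<bar>f i x - f i y\<bar> \<le> L) \<longrightarrow> mdist Y x y \<le> D L)"

lemma strong_FDC_closed:
  assumes "metric_family \<X>" "\<And>r. r > 0 \<Longrightarrow> \<exists>\<Y>\<in>strong_FDC. rn_decomposable r 1 \<X> \<Y>"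
  shows "\<X> \<in> strong_FDC"
  using closed_strong_FDC assms
  unfolding closed_under_strong_decomposition_def strongly_decomposable_def n_decomposable_def
  by blast

text \<open>
  Two different strips whose indices have the same parity have a whole interval of length \<open>w\<close>
  between their values of \<open>f Y\<close>, so the Lipschitz bound puts them at distance at least \<open>w > r\<close>.  The strips are indexed by integers,
  which keeps the family of pieces countable.
\<close>

lemma rn_decomposable_strips:
  fixes f :: "'a metric \<Rightarrow> 'a \<Rightarrow> real"
  assumes r: "0 < r" "r < w"
    and lip: "\<And>Y x y. Y \<in> \<Y> \<Longrightarrow> x \<in> mspace Y \<Longrightarrow> y \<in> mspace Y \<Longrightarrow> \<bar>f Y x - f Y y\<bar> \<le> mdist Y x y"
  shows "rn_decomposable r 1 \<Y>
           {submetric Y {x \<in> mspace Y. \<lfloor>f Y x / w\<rfloor> = k} | Y k. Y \<in> \<Y>}"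
    (is "rn_decomposable r 1 \<Y> ?\<P>")
  unfolding rn_decomposable_def
proof
  fix Y assume Y: "Y \<in> \<Y>"
  define P where "P k = {x \<in> mspace Y. \<lfloor>f Y x / w\<rfloor> = k}" for k
  define \<U> where "\<U> i = P ` {k. k mod 2 = int i}" for i :: nat
  have "mspace Y \<subseteq> (\<Union>i\<in>{0..1}. \<Union>(\<U> i))"
  proof
    fix x assume x: "x \<in> mspace Y"
    define k where "k = \<lfloor>f Y x / w\<rfloor>"
    have "x \<in> P k" using x by (simp add: P_def k_def)
    moreover have "P k \<in> \<U> (nat (k mod 2))" "nat (k mod 2) \<in> {0..1}"
      by (auto simp: \<U>_def) 
    ultimately show "x \<in> (\<Union>i\<in>{0..1}. \<Union>(\<U> i))" by blast
  qed
  moreover have "(\<Union>i\<in>{0..1}. \<Union>(\<U> i)) \<subseteq> mspace Y"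
    by (auto simp: \<U>_def P_def)
  moreover have "r_disjoint Y r (\<U> i)" for i
    unfolding r_disjoint_def
  proof (intro ballI impI)
    fix U V assume UV: "U \<in> \<U> i" "V \<in> \<U> i" "U \<noteq> V"
    obtain k where k: "U = P k" "k mod 2 = int i" using UV(1) unfolding \<U>_def by blast
    obtain l where l: "V = P l" "l mod 2 = int i" using UV(2) unfolding \<U>_def by blast
    have kl: "U = P k" "V = P l" "k mod 2 = l mod 2" "k \<noteq> l" using k l UV(3) by auto
    then have gap: "k + 2 \<le> l \<or> l + 2 \<le> k" by presburger
    have "w \<le> mdist Y u v" if "u \<in> U" "v \<in> V" for u v
    proof -
      have uv: "u \<in> mspace Y" "v \<in> mspace Y" "\<lfloor>f Y u / w\<rfloor> = k" "\<lfloor>f Y v / w\<rfloor> = l"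
        using that kl by (auto simp: P_def)
      have "1 \<le> \<bar>f Y u / w - f Y v / w\<bar>"
        using uv(3,4) gap by linarith
      also have "\<dots> = \<bar>f Y u - f Y v\<bar> / w"
        using r by (simp add: diff_divide_distrib[symmetric])
      finally have "w \<le> \<bar>f Y u - f Y v\<bar>" using r by (simp add: field_simps)
      then show ?thesis using lip[OF Y uv(1,2)] by linarith
    qed
    then have "ennreal w \<le> set_dist Y U V"
      unfolding set_dist_def by (intro INF_greatest ennreal_leI)
    then show "ennreal r < set_dist Y U V"
      using r by (meson ennreal_lessI less_le_trans order.strict_trans)
  qed
  moreover have "submetric Y U \<in> ?\<P>"
    if "U \<in> \<U> i" for U i
    using that Y by (auto simp: \<U>_def P_def)
  ultimately have "mspace Y = (\<Union>i\<in>{0..1}. \<Union>(\<U> i)) \<and>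
      (\<forall>i\<in>{0..1}. r_disjoint Y r (\<U> i) \<and> (\<forall>U\<in>\<U> i. submetric Y U \<in> ?\<P>))"
    by (intro conjI ballI equalityI)
  then show "\<exists>\<U> :: nat \<Rightarrow> 'a set set. mspace Y = (\<Union>i\<in>{0..1}. \<Union>(\<U> i)) \<and>
      (\<forall>i\<in>{0..1}. r_disjoint Y r (\<U> i) \<and> (\<forall>U\<in>\<U> i. submetric Y U \<in> ?\<P>))"
    by (rule exI[of _ \<U>])
qed

text \<open>
  Inside a strip the last coordinate varies by at most \<open>w\<close>, so the others alone control the
  distance.
\<close>

lemma coarse_coordinates_strip:
  assumes f: "coarse_coordinates (Suc m) D Y f" and w: "0 < w"
  shows "coarse_coordinates m (\<lambda>L. D (max L w))
           (submetric Y {x \<in> mspace Y. \<lfloor>f m x / w\<rfloor> = k}) f"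
proof -
  have strip: "\<bar>f m x - f m y\<bar> \<le> w" if "\<lfloor>f m x / w\<rfloor> = k" "\<lfloor>f m y / w\<rfloor> = k" for x y
  proof -
    have "\<bar>f m x / w - f m y / w\<bar> \<le> 1" using that by linarith
    moreover have "\<bar>f m x / w - f m y / w\<bar> = \<bar>f m x - f m y\<bar> / w"
      using w by (simp add: diff_divide_distrib[symmetric])
    ultimately show ?thesis using w by (simp add: field_simps)
  qed
  have "mdist Y x y \<le> D (max L w)"
    if "x \<in> mspace Y" "y \<in> mspace Y" "\<lfloor>f m x / w\<rfloor> = k" "\<lfloor>f m y / w\<rfloor> = k"
       "\<forall>i<m. \<bar>f i x - f i y\<bar> \<le> L" for x y L
  proof -
    have "\<forall>i<Suc m. \<bar>f i x - f i y\<bar> \<le> max L w"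
      using strip[OF that(3,4)] that(5) by (auto simp: less_Suc_eq max.coboundedI1 max.coboundedI2)
    then show ?thesis using f that(1,2) unfolding coarse_coordinates_def by blast
  qed
  then show ?thesis using f
    unfolding coarse_coordinates_def by auto
qed

lemma coarse_coordinates_strong_FDC:
  assumes "metric_family \<Y>" "\<And>Y. Y \<in> \<Y> \<Longrightarrow> \<exists>f. coarse_coordinates m D Y f"
  shows "\<Y> \<in> strong_FDC"
  using assms
proof (induction m arbitrary: \<Y> D)
  case 0
  have "diam Y \<le> ennreal (D 0)" if "Y \<in> \<Y>" for Y
    using 0(2)[OF that] unfolding diam_def coarse_coordinates_def
    by (auto intro!: SUP_least ennreal_leI)
  then have "(SUP Y\<in>\<Y>. diam Y) \<le> ennreal (D 0)"
    by (rule SUP_least)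
  also have "\<dots> < \<infinity>" by simp
  finally show ?case
    using 0(1) bounded_subset_strong_FDC unfolding bounded_families_def by blast
next
  case (Suc m)
  obtain f where f: "\<And>Y. Y \<in> \<Y> \<Longrightarrow> coarse_coordinates (Suc m) D Y (f Y)"
    using Suc(3) by metis
  show ?case
  proof (rule strong_FDC_closed[OF Suc(2)])
    fix r :: real assume r: "r > 0"
    define \<P> where "\<P> = {submetric Y {x \<in> mspace Y. \<lfloor>f Y m x / (r + 1)\<rfloor> = k} | Y k. Y \<in> \<Y>}"
    have "\<P> = (\<lambda>(Y, k). submetric Y {x \<in> mspace Y. \<lfloor>f Y m x / (r + 1)\<rfloor> = k}) ` (\<Y> \<times> UNIV)"
      by (auto simp: \<P>_def)
    moreover have "countable \<Y>" using Suc(2) by (simp add: metric_family_def)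
    ultimately have "metric_family \<P>" by (simp add: metric_family_def)
    then have "\<P> \<in> strong_FDC"
    proof (rule Suc.IH)
      show "\<exists>g. coarse_coordinates m (\<lambda>L. D (max L (r + 1))) P g" if P: "P \<in> \<P>" for P
      proof -
        obtain Y k where "Y \<in> \<Y>" "P = submetric Y {x \<in> mspace Y. \<lfloor>f Y m x / (r + 1)\<rfloor> = k}"
          using P unfolding \<P>_def by blast
        then show ?thesis using coarse_coordinates_strip[OF f, of Y "r + 1" k] r by auto
      qed
    qed
    moreover have "rn_decomposable r 1 \<Y> \<P>"
      unfolding \<P>_def using r f
      by (intro rn_decomposable_strips[where f = "\<lambda>Y. f Y m"]) (auto simp: coarse_coordinates_def)
    ultimately show "\<exists>\<P>\<in>strong_FDC. rn_decomposable r 1 \<Y> \<P>" by blast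
  qed
qed

section \<open>Separating a doubling set at one scale\<close>

text \<open>
  The centres of the covering balls lie in the ambient space \<open>X\<close>, where the doubling condition on
  \<open>S\<close> applies again; this is what makes the iteration possible.
\<close>

lemma doubling_iterate:
  assumes dbl: "large_scale_doubling X N R S" and r: "R \<le> r" "0 < r" and x: "x \<in> mspace X"
  shows "\<exists>C\<subseteq>mspace X. finite C \<and> card C \<le> N ^ j \<and>
           S \<inter> mball_of X x (2 ^ j * r) \<subseteq> (\<Union>c\<in>C. mball_of X c r)"
  using x
proof (induction j arbitrary: x)
  case 0
  then show ?case by (intro exI[of _ "{x}"]) auto
next
  case (Suc j)
  have "r \<le> 2 ^ j * r" using r by simp
  then have "R \<le> 2 ^ j * r" using r by linarith
  then obtain C where C: "C \<subseteq> mspace X" "finite C" "card C \<le> N"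
      "S \<inter> mball_of X x (2 * (2 ^ j * r)) \<subseteq> (\<Union>c\<in>C. mball_of X c (2 ^ j * r))"
    using dbl Suc.prems unfolding large_scale_doubling_def by meson
  have "\<forall>c\<in>C. \<exists>E\<subseteq>mspace X. finite E \<and> card E \<le> N ^ j \<and>
          S \<inter> mball_of X c (2 ^ j * r) \<subseteq> (\<Union>e\<in>E. mball_of X e r)"
    using Suc.IH C(1) by blast
  then obtain E where E: "\<And>c. c \<in> C \<Longrightarrow> E c \<subseteq> mspace X \<and> finite (E c) \<and> card (E c) \<le> N ^ j \<and>
          S \<inter> mball_of X c (2 ^ j * r) \<subseteq> (\<Union>e\<in>E c. mball_of X e r)"
    by metis
  have "card (\<Union>c\<in>C. E c) \<le> (\<Sum>c\<in>C. card (E c))"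
    by (rule card_UN_le[OF C(2)])
  also have "\<dots> \<le> (\<Sum>c\<in>C. N ^ j)" using E by (intro sum_mono) auto
  also have "\<dots> \<le> N ^ Suc j" using C(3) by simp
  finally have "card (\<Union>c\<in>C. E c) \<le> N ^ Suc j" .
  moreover have "S \<inter> mball_of X x (2 ^ Suc j * r) \<subseteq> (\<Union>e\<in>(\<Union>c\<in>C. E c). mball_of X e r)"
  proof
    fix y assume y: "y \<in> S \<inter> mball_of X x (2 ^ Suc j * r)"
    then have "y \<in> S \<inter> mball_of X x (2 * (2 ^ j * r))" by (simp add: mult.assoc)
    then obtain c where c: "c \<in> C" "y \<in> S \<inter> mball_of X c (2 ^ j * r)" using C(4) by blast
    then show "y \<in> (\<Union>e\<in>(\<Union>c\<in>C. E c). mball_of X e r)" using E[OF c(1)] by blast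
  qed
  ultimately show ?case using E C(2) by (intro exI[of _ "\<Union>c\<in>C. E c"]) blast
qed

definition separated :: "('a \<Rightarrow> 'a \<Rightarrow> real) \<Rightarrow> real \<Rightarrow> 'a set \<Rightarrow> bool" where
  "separated d e P \<longleftrightarrow> (\<forall>p\<in>P. \<forall>q\<in>P. p \<noteq> q \<longrightarrow> e \<le> d p q)"

lemma maximal_separated_subset:
  assumes sym: "\<And>x y. d x y = d y x" and refl: "\<And>x. x \<in> A \<Longrightarrow> d x x < e"
  shows "\<exists>P\<subseteq>A. separated d e P \<and> (\<forall>x\<in>A. \<exists>p\<in>P. d x p < e)"
proof -
  let ?F = "{P. P \<subseteq> A \<and> separated d e P}"
  have "\<exists>P\<in>?F. \<forall>Q\<in>?F. P \<subseteq> Q \<longrightarrow> Q = P"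
  proof (rule subset_Zorn')
    fix C assume C: "subset.chain ?F C"
    have "separated d e (\<Union>C)"
      unfolding separated_def
    proof (intro ballI impI)
      fix p q assume "p \<in> \<Union>C" "q \<in> \<Union>C" and ne: "p \<noteq> q"
      then obtain P Q where PQ: "P \<in> C" "Q \<in> C" "p \<in> P" "q \<in> Q" by blast
      then have "P \<subseteq> Q \<or> Q \<subseteq> P" "P \<in> ?F" "Q \<in> ?F" using C by (auto simp: subset_chain_def)
      then show "e \<le> d p q" using PQ ne unfolding separated_def by blast
    qed
    then show "\<Union>C \<in> ?F" using C by (auto simp: subset_chain_def)
  qed
  then obtain P where PF: "P \<in> ?F" and "\<forall>Q\<in>?F. P \<subseteq> Q \<longrightarrow> Q = P" by (elim bexE)
  then have max: "Q = P" if "Q \<subseteq> A" "separated d e Q" "P \<subseteq> Q" for Q using that by simp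
  have P: "P \<subseteq> A" "separated d e P" using PF by simp_all
  have "\<exists>p\<in>P. d x p < e" if x: "x \<in> A" for x
  proof (rule ccontr)
    assume no: "\<not> (\<exists>p\<in>P. d x p < e)"
    then have "separated d e (insert x P)"
      using P(2) sym unfolding separated_def by (auto simp: not_less)
    then have "insert x P = P" using max[of "insert x P"] P(1) x by blast
    then show False using no refl[OF x] by blast
  qed
  then show ?thesis using P by blast
qed

text \<open>
  The sets \<open>P 0, P 1, \<dots>\<close> are chosen greedily: \<open>P i\<close> is a maximal separated subset of what the
  \<open>s\<close>-balls around its predecessors leave over.  A point \<open>x\<close> that survives \<open>N ^ 6 + 1\<close> rounds has
  in each \<open>P i\<close> a point within \<open>32 * s\<close>, by maximality.  These points are mutually at distance
  at least \<open>s\<close>, hence lie in different balls of radius \<open>s / 2\<close>, whereas \<open>N ^ 6\<close> such balls cover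
  the part of \<open>S\<close> within \<open>32 * s = 2 ^ 6 * (s / 2)\<close> of \<open>x\<close>.
\<close>

lemma finitely_many_separated_sets_cover:
  assumes dbl: "large_scale_doubling X N R S" and S: "S \<subseteq> mspace X"
    and R: "0 < R" "2 * R \<le> s"
  shows "\<exists>P :: nat \<Rightarrow> 'a set. (\<forall>i. P i \<subseteq> S \<and> separated (mdist X) (32 * s) (P i)) \<and>
           (\<forall>x\<in>S. \<exists>i\<le>N ^ 6. \<exists>p\<in>P i. mdist X x p < s)"
proof -
  have s: "0 < s" using R by linarith
  have "\<exists>P\<subseteq>A. separated (mdist X) (32 * s) P \<and> (\<forall>x\<in>A. \<exists>p\<in>P. mdist X x p < 32 * s)"
    if "A \<subseteq> S" for A
  proof (rule maximal_separated_subset)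
    show "mdist X x x < 32 * s" if "x \<in> A" for x
    proof -
      have "x \<in> mspace X" using that \<open>A \<subseteq> S\<close> S by blast
      then have "mdist X x x = 0" by simp
      then show ?thesis using s by simp
    qed
  qed (rule mdist_commute)
  then obtain M where M: "\<And>A. A \<subseteq> S \<Longrightarrow> M A \<subseteq> A \<and> separated (mdist X) (32 * s) (M A) \<and>
      (\<forall>x\<in>A. \<exists>p\<in>M A. mdist X x p < 32 * s)"
    by metis
  \<comment> \<open>What is left over after the first \<open>i\<close> rounds.\<close>
  define T where
    "T = rec_nat S (\<lambda>_ A. {x \<in> A. \<forall>p\<in>M A. s \<le> mdist X x p})"
  have T_Suc: "T (Suc i) = {x \<in> T i. \<forall>p\<in>M (T i). s \<le> mdist X x p}" and T_0: "T 0 = S" for i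
    by (simp_all add: T_def)
  have T_mono: "T j \<subseteq> T i" if "i \<le> j" for i j
    using that by (induction rule: dec_induct) (auto simp: T_Suc)
  have T_S: "T i \<subseteq> S" for i using T_mono[of 0 i] T_0 by simp
  define P where "P i = M (T i)" for i
  have P: "P i \<subseteq> T i" "separated (mdist X) (32 * s) (P i)"
      "x \<in> T i \<Longrightarrow> \<exists>p\<in>P i. mdist X x p < 32 * s" for i x
    using M[OF T_S] by (auto simp: P_def)
  have "\<exists>i\<le>N ^ 6. \<exists>p\<in>P i. mdist X x p < s" if x: "x \<in> S" for x
  proof (rule ccontr)
    assume no: "\<not> (\<exists>i\<le>N ^ 6. \<exists>p\<in>P i. mdist X x p < s)"
    have "x \<in> T i" if "i \<le> N ^ 6" for i
      using that
    proof (induction i)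
      case 0
      then show ?case using x T_0 by simp
    next
      case (Suc i)
      then have "\<forall>p\<in>P i. s \<le> mdist X x p" using no by (meson not_le Suc_leD)
      then show ?case using Suc by (simp add: T_Suc P_def)
    qed
    then have "\<forall>i\<in>{..N ^ 6}. \<exists>p\<in>P i. mdist X x p < 32 * s" using P(3) by blast
    then obtain p where p: "\<And>i. i \<le> N ^ 6 \<Longrightarrow> p i \<in> P i \<and> mdist X x (p i) < 32 * s"
      by (metis atMost_iff)
    have p_sep: "s \<le> mdist X (p j) (p i)" if "i < j" "j \<le> N ^ 6" for i j
    proof -
      have "p j \<in> T (Suc i)" using p[of j] P(1) T_mono[of "Suc i" j] that by auto
      then show ?thesis using p[of i] that by (auto simp: T_Suc P_def)
    qed
    have "x \<in> mspace X" "R \<le> s / 2" "0 < s / 2" using x S R s by auto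
    then obtain C where C: "C \<subseteq> mspace X" "finite C" "card C \<le> N ^ 6"
        "S \<inter> mball_of X x (2 ^ 6 * (s / 2)) \<subseteq> (\<Union>c\<in>C. mball_of X c (s / 2))"
      using doubling_iterate[OF dbl, of "s / 2" x 6] by blast
    have "\<exists>c\<in>C. p i \<in> mball_of X c (s / 2)" if "i \<le> N ^ 6" for i
    proof -
      have "p i \<in> S" using p[OF that] P(1) T_S by blast
      moreover have "p i \<in> mball_of X x (2 ^ 6 * (s / 2))"
        using p[OF that] \<open>p i \<in> S\<close> S x by auto
      ultimately show ?thesis using C(4) by blast
    qed
    then obtain c where c: "\<And>i. i \<le> N ^ 6 \<Longrightarrow> c i \<in> C \<and> p i \<in> mball_of X (c i) (s / 2)"
      by metis
    have "\<not> inj_on c {..N ^ 6}"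
    proof
      assume "inj_on c {..N ^ 6}"
      then have "card {..N ^ 6} \<le> card C"
        using c C(2) by (intro card_inj_on_le) auto
      then show False using C(3) by simp
    qed
    then obtain i j where ij: "i < j" "j \<le> N ^ 6" "c i = c j"
      unfolding inj_on_def by (metis atMost_iff linorder_neqE_nat)
    then have "p i \<in> mball_of X (c i) (s / 2)" "p j \<in> mball_of X (c i) (s / 2)"
      using c[of i] c[of j] by auto
    then have "mdist X (p j) (p i) < s"
      using mdist_triangle[of "p j" X "c i" "p i"] by (auto simp: mdist_commute)
    then show False using p_sep[OF ij(1,2)] by linarith
  qed
  moreover have "P i \<subseteq> S" for i using P(1) T_S by blast
  ultimately show ?thesis using P(2) by (intro exI[of _ P]) blast
qed

text \<open>
  The minimum of \<open>b\<close> and the distance to \<open>P\<close>; inserting \<open>b\<close> into the set gives the value \<open>b\<close> for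
  empty \<open>P\<close>.
\<close>

definition trunc_dist :: "('a \<Rightarrow> 'a \<Rightarrow> real) \<Rightarrow> real \<Rightarrow> 'a set \<Rightarrow> 'a \<Rightarrow> real" where
  "trunc_dist d b P x = Inf (insert b (d x ` P))"

lemma trunc_dist_bounds:
  assumes "\<And>p. p \<in> P \<Longrightarrow> 0 \<le> d x p" "0 \<le> b"
  shows "trunc_dist d b P x \<le> b" "0 \<le> trunc_dist d b P x"
    "p \<in> P \<Longrightarrow> trunc_dist d b P x \<le> d x p"
proof -
  have bdd: "bdd_below (insert b (d x ` P))"
    by (rule bdd_belowI[of _ 0]) (use assms in auto)
  show "trunc_dist d b P x \<le> b" "p \<in> P \<Longrightarrow> trunc_dist d b P x \<le> d x p"
    unfolding trunc_dist_def by (auto intro!: cInf_lower[OF _ bdd])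
  show "0 \<le> trunc_dist d b P x"
    unfolding trunc_dist_def by (rule cInf_greatest) (use assms in auto)
qed

lemma trunc_dist_ge:
  assumes "\<And>p. p \<in> P \<Longrightarrow> a \<le> d x p" "a \<le> b"
  shows "a \<le> trunc_dist d b P x"
  unfolding trunc_dist_def by (rule cInf_greatest) (use assms in auto)

text \<open>
  Let \<open>x\<close> be within \<open>s\<close> of \<open>p \<in> P i\<close>, and let the distance of \<open>x\<close> and \<open>y\<close> be between \<open>4 * s\<close> and
  \<open>16 * s\<close>.  Then \<open>y\<close> is at distance at least \<open>2 * s\<close> from all of \<open>P i\<close>: from \<open>p\<close> because \<open>x\<close> is
  near \<open>p\<close>, and from the other points because these are \<open>32 * s\<close> away from \<open>p\<close>.  So the truncated
  distance to \<open>P i\<close> is below \<open>s\<close> at \<open>x\<close> and equal to \<open>2 * s\<close> at \<open>y\<close>.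
\<close>

lemma separating_functions:
  assumes dbl: "large_scale_doubling X N R S" and S: "S \<subseteq> mspace X"
    and R: "0 < R" "2 * R \<le> s"
  shows "\<exists>\<psi> :: nat \<Rightarrow> 'a \<Rightarrow> real.
           (\<forall>i. \<forall>x\<in>S. 0 \<le> \<psi> i x \<and> \<psi> i x \<le> 2 * s) \<and>
           (\<forall>i. \<forall>x\<in>S. \<forall>y\<in>S. \<bar>\<psi> i x - \<psi> i y\<bar> \<le> mdist X x y) \<and>
           (\<forall>x\<in>S. \<forall>y\<in>S. 4 * s \<le> mdist X x y \<and> mdist X x y \<le> 16 * s \<longrightarrow>
              (\<exists>i\<le>N ^ 6. s \<le> \<bar>\<psi> i x - \<psi> i y\<bar>))"
proof -
  have s: "0 < s" using R by linarith
  obtain P where P: "\<And>i. P i \<subseteq> S" "\<And>i. separated (mdist X) (32 * s) (P i)"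
      "\<And>x. x \<in> S \<Longrightarrow> \<exists>i\<le>N ^ 6. \<exists>p\<in>P i. mdist X x p < s"
    using finitely_many_separated_sets_cover[OF assms] by blast
  have tri: "mdist X x z \<le> mdist X x y + mdist X y z" if "x \<in> S" "y \<in> S" "z \<in> S" for x y z
    using that S by (intro mdist_triangle) auto
  define \<psi> where "\<psi> i = trunc_dist (mdist X) (2 * s) (P i)" for i
  have \<psi>: "0 \<le> \<psi> i x" "\<psi> i x \<le> 2 * s" "p \<in> P i \<Longrightarrow> \<psi> i x \<le> mdist X x p" for i x p
    unfolding \<psi>_def using s by (auto intro!: trunc_dist_bounds)
  have half: "\<psi> i x - mdist X x y \<le> \<psi> i y" if "x \<in> S" "y \<in> S" for i x y
  proof -
    have "\<psi> i x - mdist X x y \<le> mdist X y p" if p: "p \<in> P i" for p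
    proof -
      have "\<psi> i x \<le> mdist X x p" using \<psi>(3) p .
      also have "\<dots> \<le> mdist X x y + mdist X y p"
        using p P(1) \<open>x \<in> S\<close> \<open>y \<in> S\<close> by (intro tri) auto
      finally show ?thesis by simp
    qed
    moreover have "\<psi> i x - mdist X x y \<le> 2 * s"
      using \<psi>(2)[of i x] mdist_nonneg[of X x y] by linarith
    ultimately show ?thesis unfolding \<psi>_def by (intro trunc_dist_ge)
  qed
  have lip: "\<bar>\<psi> i x - \<psi> i y\<bar> \<le> mdist X x y" if "x \<in> S" "y \<in> S" for i x y
    using half[OF that, of i] half[OF that(2,1), of i] by (simp add: mdist_commute abs_le_iff)
  have "\<exists>i\<le>N ^ 6. s \<le> \<bar>\<psi> i x - \<psi> i y\<bar>"
    if xy: "x \<in> S" "y \<in> S" and d: "4 * s \<le> mdist X x y" "mdist X x y \<le> 16 * s" for x y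
  proof -
    obtain i p where i: "i \<le> N ^ 6" and p: "p \<in> P i" "mdist X x p < s"
      using P(3)[OF xy(1)] by blast
    have pS: "p \<in> S" using p P(1) by blast
    have "2 * s \<le> mdist X y q" if q: "q \<in> P i" for q
    proof (cases "q = p")
      case True
      then show ?thesis
        using tri[OF xy(1) pS xy(2)] d p(2) s True mdist_commute[of X p y] by simp
    next
      case False
      have qS: "q \<in> S" using q P(1) by blast
      have "32 * s \<le> mdist X p q"
        using P(2)[of i] p(1) q False by (simp add: separated_def)
      then show ?thesis
        using tri[OF pS xy(1) qS] tri[OF xy qS] d p(2) s mdist_commute[of X p x] by linarith
    qed
    then have "2 * s \<le> \<psi> i y" unfolding \<psi>_def by (intro trunc_dist_ge) auto
    moreover have "\<psi> i x < s" using \<psi>(3)[OF p(1), of x] p(2) by linarith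
    ultimately show ?thesis using i by (intro exI[of _ i]) auto
  qed
  then show ?thesis using \<psi>(1,2) lip by (intro exI[of _ \<psi>]) blast
qed

section \<open>Assembling all scales\<close>

lemma summable_weights: "summable (\<lambda>k. c * (1 / 64) ^ k / 64 :: real)"
  by (intro summable_divide summable_mult) simp

lemma suminf_weights: "(\<Sum>k. c * (1 / 64) ^ k / 64 :: real) = c / 63"
proof -
  have "(\<lambda>k. (1 / 64) ^ k :: real) sums (64 / 63)"
    using geometric_sums[of "1 / 64 :: real"] by simp
  then have "(\<lambda>k. c * (1 / 64) ^ k / 64) sums (c * (64 / 63) / 64)"
    by (intro sums_divide sums_mult)
  then show ?thesis by (simp add: sums_iff)
qed

lemma multiscale_sum_upper:
  fixes a :: "nat \<Rightarrow> real"
  assumes "\<And>k. \<bar>a k\<bar> \<le> d"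
  shows "summable (\<lambda>k. a k / 64 ^ Suc k)" and "\<bar>\<Sum>k. a k / 64 ^ Suc k\<bar> \<le> d / 63"
proof -
  have le: "norm (a k / 64 ^ Suc k) \<le> d * (1 / 64) ^ k / 64" for k
    using assms[of k] by (simp add: power_divide field_simps)
  show "summable (\<lambda>k. a k / 64 ^ Suc k)"
    by (rule summable_comparison_test'[OF summable_weights[of d]]) (rule le)
  have "norm (\<Sum>k. a k / 64 ^ Suc k) \<le> (\<Sum>k. d * (1 / 64) ^ k / 64)"
    by (rule norm_suminf_le[OF le summable_weights])
  then show "\<bar>\<Sum>k. a k / 64 ^ Suc k\<bar> \<le> d / 63" by (simp add: suminf_weights)
qed

text \<open>
  With the scales \<open>\<rho> * 4096 ^ k\<close> and the weights \<open>1 / 64 ^ Suc k\<close>, the term of index \<open>n\<close> is at least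
  \<open>\<rho> * 64 ^ n / 64\<close>.  Geometric series bound the terms above \<open>n\<close>, through \<open>d\<close>, by \<open>16 / 63\<close> of
  this, and the terms below \<open>n\<close>, through their scale, by \<open>2 / 63\<close>.  Together this is less than half.
\<close>

lemma multiscale_sum_lower:
  fixes a :: "nat \<Rightarrow> real"
  assumes \<rho>: "0 < \<rho>" and ad: "\<And>k. \<bar>a k\<bar> \<le> d" and ak: "\<And>k. \<bar>a k\<bar> \<le> 2 * (\<rho> * 4096 ^ k)"
    and an: "\<rho> * 4096 ^ n \<le> \<bar>a n\<bar>" and d: "d \<le> 16 * (\<rho> * 4096 ^ n)"
  shows "\<rho> * 64 ^ n / 128 \<le> \<bar>\<Sum>k. a k / 64 ^ Suc k\<bar>"
proof -
  define b where "b k = a k / 64 ^ Suc k" for k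
  have split64: "(4096 :: real) ^ k = 64 ^ k * 64 ^ k" for k
    by (simp flip: power_mult_distrib)
  have "summable b" unfolding b_def using multiscale_sum_upper(1)[OF ad] .
  then have "suminf b = (\<Sum>k. b (k + Suc n)) + (\<Sum>k<Suc n. b k)"
    by (rule suminf_split_initial_segment)
  then have eq: "suminf b = (\<Sum>k. b (k + Suc n)) + b n + (\<Sum>k<n. b k)" by simp
  have main: "\<rho> * 64 ^ n / 64 \<le> \<bar>b n\<bar>"
    using an by (simp add: b_def field_simps split64 abs_mult)
  have "\<bar>\<Sum>k. b (k + Suc n)\<bar> = \<bar>\<Sum>k. (a (k + Suc n) / 64 ^ Suc n) / 64 ^ Suc k\<bar>"
    by (simp add: b_def power_add mult_ac)
  also have "\<dots> \<le> (d / 64 ^ Suc n) / 63"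
    using ad by (intro multiscale_sum_upper(2)) (simp add: divide_right_mono)
  also have "\<dots> \<le> (16 * (\<rho> * 4096 ^ n) / 64 ^ Suc n) / 63"
    using d by (intro divide_right_mono) auto
  also have "\<dots> = 16 / 63 * (\<rho> * 64 ^ n / 64)"
    by (simp add: split64)
  finally have tail: "\<bar>\<Sum>k. b (k + Suc n)\<bar> \<le> 16 / 63 * (\<rho> * 64 ^ n / 64)" .
  have "\<bar>\<Sum>k<n. b k\<bar> \<le> (\<Sum>k<n. \<bar>b k\<bar>)" by (rule sum_abs)
  also have "\<dots> \<le> (\<Sum>k<n. \<rho> / 32 * 64 ^ k)"
  proof (rule sum_mono)
    fix k
    show "\<bar>b k\<bar> \<le> \<rho> / 32 * 64 ^ k"
      using ak[of k] by (simp add: b_def field_simps split64)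
  qed
  also have "\<dots> = \<rho> / 32 * ((64 ^ n - 1) / 63)"
    by (simp only: sum_distrib_left[symmetric]) (simp add: geometric_sum)
  also have "\<dots> \<le> 2 / 63 * (\<rho> * 64 ^ n / 64)"
    using \<rho> by (simp add: field_simps)
  finally have head: "\<bar>\<Sum>k<n. b k\<bar> \<le> 2 / 63 * (\<rho> * 64 ^ n / 64)" .
  have "0 \<le> \<rho> * 64 ^ n / 64" using \<rho> by simp
  then show ?thesis using eq main tail head unfolding b_def[symmetric] by linarith
qed

lemma scale_index:
  fixes z :: real
  assumes "1 \<le> z"
  shows "\<exists>n. 4 ^ n \<le> z \<and> z < 4 ^ Suc n"
proof -
  obtain m where m: "z < 4 ^ m" using real_arch_pow[of 4 z] by auto
  define l where "l = (LEAST m. z < 4 ^ m)"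
  have l: "z < 4 ^ l" unfolding l_def using m by (rule LeastI)
  then obtain n where n: "l = Suc n" using assms by (cases l) auto
  have "\<not> z < 4 ^ n" using not_less_Least[of n "\<lambda>m. z < 4 ^ m"] n by (simp add: l_def)
  then show ?thesis using l n by (intro exI[of _ n]) auto
qed

text \<open>
  Every distance from \<open>8 * R\<close> on is between 4 and 16 times one of the scales \<open>2 * R * 4 ^ n\<close>.  These
  are distributed by \<open>n mod 6\<close> over six sequences of ratio \<open>4 ^ 6 = 4096\<close>, as required by
  \<open>multiscale_sum_lower\<close>, and each pair of a sequence and a colour yields one coordinate.
  Neither the number of coordinates nor the control depends on \<open>S\<close>.
\<close>

lemma doubling_coarse_coordinates:
  assumes R: "0 < R"
  shows "\<exists>D. \<forall>S. S \<subseteq> mspace X \<and> large_scale_doubling X N R S \<longrightarrow>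
           (\<exists>f. coarse_coordinates (6 * Suc (N ^ 6)) D (submetric X S) f)"
proof -
  \<comment> \<open>The smallest scale of the sequence with residue \<open>j\<close>.\<close>
  define \<rho> where "\<rho> j = 2 * R * 4 ^ j" for j :: nat
  have \<rho>: "2 * R \<le> \<rho> j" for j
    using R by (simp add: \<rho>_def)
  have "\<exists>k. 64 * L / R < 64 ^ k" for L :: real by (rule real_arch_pow) simp
  then obtain \<kappa> where \<kappa>: "\<And>L :: real. 64 * L / R < 64 ^ \<kappa> L" by metis
  \<comment> \<open>Beyond the distance \<open>D L\<close> the relevant scale has index at least \<open>\<kappa> L\<close> in its sequence, and the bound of
    \<open>multiscale_sum_lower\<close> exceeds \<open>L\<close>.\<close>
  define D where "D L = 8 * R * 4096 ^ \<kappa> L" for L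
  have "\<exists>f. coarse_coordinates (6 * Suc (N ^ 6)) D (submetric X S) f"
    if S: "S \<subseteq> mspace X" and dbl: "large_scale_doubling X N R S" for S
  proof (cases "S = {}")
    case True
    then show ?thesis by (auto simp: coarse_coordinates_def)
  next
    case False
    then obtain x0 where x0: "x0 \<in> S" by blast
    have scale: "2 * R \<le> \<rho> j * 4096 ^ k" for j k
    proof -
      have "\<rho> j * 1 \<le> \<rho> j * 4096 ^ k" using \<rho>[of j] R by (intro mult_left_mono) auto
      then show ?thesis using \<rho>[of j] by linarith
    qed
    obtain \<psi> where
      \<psi>_bd: "\<And>j k i x. x \<in> S \<Longrightarrow> 0 \<le> \<psi> j k i x \<and> \<psi> j k i x \<le> 2 * (\<rho> j * 4096 ^ k)" and
      \<psi>_lip: "\<And>j k i x y. x \<in> S \<Longrightarrow> y \<in> S \<Longrightarrow> \<bar>\<psi> j k i x - \<psi> j k i y\<bar> \<le> mdist X x y" and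
      \<psi>_sep: "\<And>j k x y. x \<in> S \<Longrightarrow> y \<in> S \<Longrightarrow> 4 * (\<rho> j * 4096 ^ k) \<le> mdist X x y \<Longrightarrow>
          mdist X x y \<le> 16 * (\<rho> j * 4096 ^ k) \<Longrightarrow>
          \<exists>i\<le>N ^ 6. \<rho> j * 4096 ^ k \<le> \<bar>\<psi> j k i x - \<psi> j k i y\<bar>"
      using separating_functions[OF dbl S R scale] by metis
    \<comment> \<open>The terms themselves grow with \<open>k\<close>; subtracting the value at a base point makes the
      series converge, and cancels in differences.\<close>
    define g where "g j i x = (\<Sum>k. (\<psi> j k i x - \<psi> j k i x0) / 64 ^ Suc k)" for j i x
    have g_diff: "g j i x - g j i y = (\<Sum>k. (\<psi> j k i x - \<psi> j k i y) / 64 ^ Suc k)"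
      if "x \<in> S" "y \<in> S" for j i x y
    proof -
      have "summable (\<lambda>k. (\<psi> j k i x - \<psi> j k i x0) / 64 ^ Suc k)" if "x \<in> S" for x
        using \<psi>_lip[OF that x0] by (rule multiscale_sum_upper(1))
      then have "g j i x - g j i y =
          (\<Sum>k. (\<psi> j k i x - \<psi> j k i x0) / 64 ^ Suc k - (\<psi> j k i y - \<psi> j k i x0) / 64 ^ Suc k)"
        unfolding g_def using that by (intro suminf_diff) auto
      then show ?thesis by (simp flip: diff_divide_distrib)
    qed
    have g_lip: "\<bar>g j i x - g j i y\<bar> \<le> mdist X x y" if "x \<in> S" "y \<in> S" for j i x y
    proof -
      have "\<bar>g j i x - g j i y\<bar> \<le> mdist X x y / 63"
        unfolding g_diff[OF that] using \<psi>_lip[OF that] by (rule multiscale_sum_upper(2))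
      then show ?thesis using mdist_nonneg[of X x y] by linarith
    qed
    have g_coarse: "\<exists>j<6. \<exists>i\<le>N ^ 6. L < \<bar>g j i x - g j i y\<bar>"
      if xy: "x \<in> S" "y \<in> S" and far: "D L < mdist X x y" for x y L
    proof -
      define z where "z = mdist X x y / (8 * R)"
      have z: "4096 ^ \<kappa> L < z" using far R by (simp add: z_def D_def field_simps)
      moreover have "(1 :: real) \<le> 4096 ^ \<kappa> L" by simp
      ultimately have "1 \<le> z" by linarith
      then obtain n where n: "4 ^ n \<le> z" "z < 4 ^ Suc n" using scale_index by blast
      define j k where "j = n mod 6" and "k = n div 6"
      have n_eq: "n = j + 6 * k" by (simp add: j_def k_def)
      have \<rho>k: "\<rho> j * 4096 ^ k = 2 * R * 4 ^ n"
        by (simp add: \<rho>_def n_eq power_add power_mult)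
      have lo: "4 * (\<rho> j * 4096 ^ k) \<le> mdist X x y" and hi: "mdist X x y \<le> 16 * (\<rho> j * 4096 ^ k)"
        using n R by (simp_all add: \<rho>k z_def field_simps)
      obtain i where i: "i \<le> N ^ 6" "\<rho> j * 4096 ^ k \<le> \<bar>\<psi> j k i x - \<psi> j k i y\<bar>"
        using \<psi>_sep[OF xy lo hi] by blast
      have "\<rho> j * 64 ^ k / 128 \<le> \<bar>g j i x - g j i y\<bar>"
        unfolding g_diff[OF xy]
      proof (rule multiscale_sum_lower[where n = k and d = "mdist X x y"])
        show "0 < \<rho> j" using \<rho>[of j] R by linarith
        show "\<bar>\<psi> j l i x - \<psi> j l i y\<bar> \<le> mdist X x y" for l by (rule \<psi>_lip[OF xy])
        show "\<rho> j * 4096 ^ k \<le> \<bar>\<psi> j k i x - \<psi> j k i y\<bar>" by (rule i(2))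
        show "mdist X x y \<le> 16 * (\<rho> j * 4096 ^ k)" by (rule hi)
        show "\<bar>\<psi> j l i x - \<psi> j l i y\<bar> \<le> 2 * (\<rho> j * 4096 ^ l)" for l
          using \<psi>_bd[OF xy(1), of j l i] \<psi>_bd[OF xy(2), of j l i] by linarith
      qed
      moreover have "\<kappa> L \<le> k"
      proof -
        have "(4 :: real) ^ (6 * \<kappa> L) < 4 ^ Suc n" using z n(2) by (simp add: power_mult)
        then have "6 * \<kappa> L < Suc n" by (simp only: power_strict_increasing_iff) 
        then show ?thesis by (simp add: k_def)
      qed
      moreover have "2 * R * 64 ^ \<kappa> L / 128 \<le> \<rho> j * 64 ^ k / 128" if "\<kappa> L \<le> k"
        using that R \<rho>[of j] by (intro divide_right_mono mult_mono power_increasing) auto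
      moreover have "L < 2 * R * 64 ^ \<kappa> L / 128" using \<kappa>[of L] R by (simp add: field_simps)
      ultimately have "L < \<bar>g j i x - g j i y\<bar>" by linarith
      moreover have "j < 6" by (simp add: j_def)
      ultimately show ?thesis using i(1) by blast
    qed
    define f where "f l = g (l mod 6) (l div 6)" for l
    have "mdist X x y \<le> D L"
      if xy: "x \<in> S" "y \<in> S" and L: "\<forall>l<6 * Suc (N ^ 6). \<bar>f l x - f l y\<bar> \<le> L" for x y L
    proof (rule ccontr)
      assume "\<not> mdist X x y \<le> D L"
      then obtain j i where ij: "j < 6" "i \<le> N ^ 6" "L < \<bar>g j i x - g j i y\<bar>"
        using g_coarse[OF xy, of L] by auto
      have "j + 6 * i < 6 * Suc (N ^ 6)" using ij(1) mult_le_mono2[OF ij(2), of 6] by simp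
      then have "\<bar>f (j + 6 * i) x - f (j + 6 * i) y\<bar> \<le> L" using L by blast
      then show False using ij by (simp add: f_def)
    qed
    then have "coarse_coordinates (6 * Suc (N ^ 6)) D (submetric X S) f"
      using g_lip S unfolding coarse_coordinates_def f_def by (auto simp: Int_absorb2)
    then show ?thesis by blast
  qed
  then show ?thesis by blast
qed

section \<open>Weak hyperbolic dimension and decomposition complexity\<close>

lemma weakly_LSD_subset_strong_FDC: "weakly_LSD_families X \<subseteq> strong_FDC"
proof
  fix \<Y> assume "\<Y> \<in> weakly_LSD_families X"
  then obtain \<S> N R where \<Y>: "metric_family \<Y>" "\<Y> = submetric X ` \<S>" and R: "R > 0"
    and \<S>: "\<forall>S\<in>\<S>. S \<subseteq> mspace X" "\<forall>S\<in>\<S>. large_scale_doubling X N R S"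
    unfolding weakly_LSD_families_def by (elim CollectE conjE exE) (rule that)
  obtain D where D: "\<forall>S. S \<subseteq> mspace X \<and> large_scale_doubling X N R S \<longrightarrow>
      (\<exists>f. coarse_coordinates (6 * Suc (N ^ 6)) D (submetric X S) f)"
    using doubling_coarse_coordinates[OF R, of X N] ..
  show "\<Y> \<in> strong_FDC"
  proof (rule coarse_coordinates_strong_FDC[OF \<Y>(1)])
    fix Y assume "Y \<in> \<Y>"
    then obtain S where S: "S \<in> \<S>" and Y: "Y = submetric X S" using \<Y>(2) by blast
    then have "S \<subseteq> mspace X" "large_scale_doubling X N R S" using \<S> by auto
    then show "\<exists>f. coarse_coordinates (6 * Suc (N ^ 6)) D Y f" unfolding Y using D by simp
  qed
qed

lemma strong_FDC_subset_weak_FDC: "strong_FDC \<subseteq> weak_FDC"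
proof -
  have "closed_under_strong_decomposition weak_FDC"
    using closed_weak_FDC
    unfolding closed_under_weak_decomposition_def closed_under_strong_decomposition_def
      weakly_decomposable_def strongly_decomposable_def by blast
  then show ?thesis
    using metric_family_weak_FDC bounded_subset_weak_FDC unfolding strong_FDC_def by blast
qed

theorem theorem4p6:
  fixes X :: "'a metric"
  shows "(weak_hyperbolic_dim X < \<infinity> \<longrightarrow> {X} \<in> weak_FDC) \<and>
         (weak_hyperbolic_dim_at_most X 1 \<longrightarrow> {X} \<in> strong_FDC)"
proof (intro conjI impI)
  have X: "metric_family {X}" by (simp add: metric_family_def)
  show "{X} \<in> weak_FDC" if "weak_hyperbolic_dim X < \<infinity>"
  proof -
    have "{enat n | n. weak_hyperbolic_dim_at_most X n} \<noteq> {}"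
    proof
      assume "{enat n | n. weak_hyperbolic_dim_at_most X n} = {}"
      then show False using that unfolding weak_hyperbolic_dim_def by (simp add: top_enat_def)
    qed
    then obtain n where "n_decomposable n {X} (weakly_LSD_families X)"
      unfolding weak_hyperbolic_dim_at_most_def by blast
    then have "n_decomposable n {X} weak_FDC"
      by (rule n_decomposable_mono)
        (use weakly_LSD_subset_strong_FDC strong_FDC_subset_weak_FDC in blast)
    then show ?thesis
      using closed_weak_FDC X
      unfolding closed_under_weak_decomposition_def weakly_decomposable_def by blast
  qed
  show "{X} \<in> strong_FDC" if "weak_hyperbolic_dim_at_most X 1"
  proof -
    have "n_decomposable 1 {X} strong_FDC"
      using that weakly_LSD_subset_strong_FDC
      unfolding weak_hyperbolic_dim_at_most_def by (rule n_decomposable_mono)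
    then show ?thesis
      using closed_strong_FDC X
      unfolding closed_under_strong_decomposition_def strongly_decomposable_def by blast
  qed
qed

end
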